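(* Consider the stochastic network access allocation problem (S) defined in the context, with a primal-dual optimal solution (denoted by $\star$), access prices (LMAP-S) $\overline{\boldsymbol\Lambda}^\star:=\sum_{s=1}^S\overline{\boldsymbol\lambda}^\star[s]$ and $\underline{\boldsymbol\Lambda}^\star:=\sum_{s=1}^S\underline{\boldsymbol\lambda}^\star[s]$, payments $\tilde{\mathcal P}_k:=\overline{\boldsymbol\Lambda}^{\star\top}\overline{\mathbf C}_k^\star+\underline{\boldsymbol\Lambda}^{\star\top}\underline{\mathbf C}_k^\star$, and surpluses $$\tilde\Pi^{\mathrm{DSO}}:=\sum_{k=1}^K\tilde{\mathcal P}_k-\frac1S\sum_{s=1}^S\big(J(\overline{\mathbf P}^\star[s],\underline{\mathbf P}^\star[s])-J(\mathbf p_0[s],-\mathbf p_0[s])\big),\qquad \tilde\Pi_k^{\mathrm{DERA}}:=\varphi_k(\underline{\mathbf C}_k^\star,\overline{\mathbf C}_k^\star)-\tilde{\mathcal P}_k .$$ The following statements hold. (a) $$\overline{\boldsymbol\Lambda}^\star=\sum_{s=1}^S\frac1S\nabla_{\overline{\mathbf P}[s]}J(\overline{\mathbf P}^\star[s],\underline{\mathbf P}^\star[s])+\sum_{s=1}^S\big(\mathbf A_+^\top\overline{\boldsymbol\beta}^\star[s]+\mathbf A_-^\top\underline{\boldsymbol\beta}^\star[s]+\overline{\boldsymbol\omega}^\star[s]\big),$$ $$\underline{\boldsymbol\Lambda}^\star=\sum_{s=1}^S\frac1S\nabla_{\underline{\mathbf P}[s]}J(\overline{\mathbf P}^\star[s],\underline{\mathbf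 P}^\star[s])+\sum_{s=1}^S\big(\mathbf A_+^\top\underline{\boldsymbol\beta}^\star[s]+\mathbf A_-^\top\overline{\boldsymbol\beta}^\star[s]+\underline{\boldsymbol\omega}^\star[s]\big).$$ (b) $\tilde\Pi^{\mathrm{DSO}}\ge0$. (c) For each $k$, $\tilde\Pi_k^{\mathrm{DERA}}\ge0$ if $\varphi_k(\mathbf 0,\mathbf 0)\ge0$ and one of the following two conditions holds: $\overline{\mathbf C}_k^{\min}=\mathbf 0$ and $\underline{\mathbf C}_k^{\min}=\mathbf 0$; or the minimum access constraints are non-binding at optimality, i.e., $\overline{\mathbf C}_k^\star>\overline{\mathbf C}_k^{\min}$ and $\underline{\mathbf C}_k^\star>\underline{\mathbf C}_k^{\min}$ (element-wise). (d) Let $\mathbf A$ be the LinDistFlow matrix of a radial network on buses $1,\dots,N$. When $J$ is linear and homogeneous across buses, i.e., $J(\overline{\mathbf P}[s],\underline{\mathbf P}[s])=\sum_{i=1}^N\overline J\,\overline P^{(i)}[s]+\sum_{i=1}^N\underline J\,\underline P^{(i)}[s]$ for scalars $\overline J,\underline J$, and the constraints $\overline{\mathbf P}[s]\le\overline{\mathbf P}^{\max}$, $\underline{\mathbf P}[s]\le\underline{\mathbf P}^{\max}$ are non-binding at optimality at all buses and in all scenarios (strict inequality in every component for every $s$), then $\overline\Lambda^{(n)\star}\ge\overline\Lambda^{(m)\star}$ and $\underline\Lambda^{(n)\star}\ge\underline\Lambda^{(m)\star}$ whenever bus $m$ is an ancestor of bus $n$.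
   Context: All vector inequalities are element-wise; superscript $(i)$ denotes the $i$-th (bus $i$) component. For a scalar $z$, $z_+:=\max\{z,0\}$, $z_-:=z_+-z$, applied element-wise to matrices, so $\mathbf A=\mathbf A_+-\mathbf A_-$. Problem (S). Data: positive integers $K,N,M,S$; $\delta\in[0,1)$; $\mathbf A\in\mathbb{R}^{M\times N}$ (arbitrary for parts (a)–(c)); $\underline{\mathbf b},\overline{\mathbf b}\in\mathbb{R}^M$; element-wise nonnegative $\overline{\mathbf C}_k^{\min},\underline{\mathbf C}_k^{\min},\overline{\mathbf P}^{\max},\underline{\mathbf P}^{\max}\in\mathbb{R}^N$; scenario vectors $\mathbf p_0[1],\dots,\mathbf p_0[S]\in\mathbb{R}^N$ (samples of the power injections of the DSO's customers); concave non-decreasing $\varphi_k:\mathbb{R}^{2N}\to\mathbb{R}$, $k=1,\dots,K$; convex non-decreasing differentiable $J:\mathbb{R}^{2N}\to\mathbb{R}$. Over $\overline{\mathbf C}_k,\underline{\mathbf C}_k,\overline{\mathbf P}[s],\underline{\mathbf P}[s]\in\mathbb{R}^N$ and $\overline{\mathbf t},\underline{\mathbf t},\overline{\boldsymbol\gamma}[s],\underline{\boldsymbol\gamma}[s]\in\mathbb{R}^M$, maximize $$\sum_{k=1}^K\varphi_k(\underline{\mathbf C}_k,\overline{\mathbf C}_k)-\frac1S\sum_{s=1}^SJ(\overline{\mathbf P}[s],\underline{\mathbf P}[s])$$ subject to, for $k=1,\dots,K$ and $s=1,\dots,S$ (multipliers in brackets; inequality multipliers are nonnegative), - $[\overline{\boldsymbol\eta}_k,\underline{\boldsymbol\eta}_k]$: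 $\overline{\mathbf C}_k^{\min}\le\overline{\mathbf C}_k$, $\underline{\mathbf C}_k^{\min}\le\underline{\mathbf C}_k$ (the minimum access constraints); - $[\overline{\boldsymbol\omega}[s],\underline{\boldsymbol\omega}[s]]$: $\overline{\mathbf P}[s]\le\overline{\mathbf P}^{\max}$, $\underline{\mathbf P}[s]\le\underline{\mathbf P}^{\max}$; - $[\overline{\boldsymbol\lambda}[s]\text{ free}]$: $\overline{\mathbf P}[s]=\sum_k\overline{\mathbf C}_k+\mathbf p_0[s]$; - $[\underline{\boldsymbol\lambda}[s]\text{ free}]$: $\underline{\mathbf P}[s]=\sum_k\underline{\mathbf C}_k-\mathbf p_0[s]$; - $[\overline{\boldsymbol\beta}[s]]$: $\mathbf A_+\overline{\mathbf P}[s]+\mathbf A_-\underline{\mathbf P}[s]-\overline{\mathbf b}-\overline{\mathbf t}\le\overline{\boldsymbol\gamma}[s]$; - $[\overline{\boldsymbol\alpha}[s]]$: $\mathbf 0\le\overline{\boldsymbol\gamma}[s]$; - $[\overline{\boldsymbol\mu}]$: $\overline{\mathbf t}+\frac1{1-\delta}\frac1S\sum_{s}\overline{\boldsymbol\gamma}[s]\le\mathbf 0$; - $[\underline{\boldsymbol\beta}[s]]$: $\mathbf A_-\overline{\mathbf P}[s]+\mathbf A_+\underline{\mathbf P}[s]+\underline{\mathbf b}-\underline{\mathbf t}\le\underline{\boldsymbol\gamma}[s]$; - $[\underline{\boldsymbol\alpha}[s]]$: $\mathbf 0\le\underline{\boldsymbol\gamma}[s]$; - $[\underline{\boldsymbol\mu}]$: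 $\underline{\mathbf t}+\frac1{1-\delta}\frac1S\sum_{s}\underline{\boldsymbol\gamma}[s]\le\mathbf 0$. The Lagrangian $\mathcal L$ is minus the objective, plus the sum over inequality constraints (written as $g\le0$) of multiplier$^\top g$, plus $\sum_s\overline{\boldsymbol\lambda}[s]^\top(\sum_k\overline{\mathbf C}_k+\mathbf p_0[s]-\overline{\mathbf P}[s])+\sum_s\underline{\boldsymbol\lambda}[s]^\top(\sum_k\underline{\mathbf C}_k-\mathbf p_0[s]-\underline{\mathbf P}[s])$. A primal-dual optimal solution means: the primal point is feasible, inequality multipliers are nonnegative, complementary slackness holds for every inequality constraint, and the primal point minimizes $\mathcal L$ (at the given multipliers) over all values of the primal variables. $\nabla_{\overline{\mathbf P}[s]}J$ and $\nabla_{\underline{\mathbf P}[s]}J$ are the partial gradients of $J$ in its first and second $N$-vector arguments. Network (for part (d)). The network is a tree on buses $\{1,\dots,N\}$ with $N-1$ edges (lines); bus $1$ is the reference bus. Bus $m$ is an ancestor of bus $n$ if $m$ lies on the unique undirected path from bus $1$ to bus $n$. Let $\tilde{\mathbf S}\in\{0,1\}^{(N-1)\times(N-1)}$ have rows indexed by edges $e$ and columns by buses $j=2,\dots,N$, with $\tilde S^{(e,j)}=1$ if edge $e$ lies on the path between bus $1$ and bus $j$, and $0$ otherwise. Let $\mathbf D=\mathrm{diag}(\mathbf r+\alpha\mathbf x)$, where $\mathbf r,\mathbf x\in\mathbb{R}^{N-1}$ collect line resistances and reactances and $\alpha$ is the fixed ratio of reactive to real power injection; $\mathbf D$ is element-wise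 nonnegative. The LinDistFlow matrix is $$\mathbf A=\begin{pmatrix}\mathbf 0&\tilde{\mathbf S}\\ \mathbf 0&2\tilde{\mathbf S}^\top\mathbf D\tilde{\mathbf S}\end{pmatrix}\in\mathbb{R}^{2(N-1)\times N},$$ where the first (zero) column corresponds to bus $1$; $\underline{\mathbf b},\overline{\mathbf b}\in\mathbb{R}^{2(N-1)}$ collect the lower and upper limits on line flows and on squared voltage magnitudes (the latter offset by the contribution of the reference bus voltage). *)

theory Defs
  imports "HOL-Analysis.Analysis"
begin

section \<open>The stochastic network access allocation problem\<close>

text \<open>
  The index sets of DERAs, buses, rows of the flow matrix and scenarios are finite types
  \<open>'k\<close>, \<open>'n\<close>, \<open>'m\<close>, \<open>'s\<close>, so \<open>K\<close>, \<open>N\<close>, \<open>M\<close>, \<open>S\<close> are arbitrary positive integers.  The suffix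
  \<open>hi\<close> stands for an overline and \<open>lo\<close> for an underline.  Functions on \<open>\<real>\<^sup>2\<^sup>N\<close> take a pair of
  \<open>N\<close>-vectors; the argument order is (underline, overline) for \<open>phi\<close> and (overline, underline)
  for \<open>Jcost\<close>.
\<close>

record ('k, 'n, 'm, 's) access_data =
  flowmat :: "real ^ ('n::finite) ^ ('m::finite)"
  b_hi :: "real ^ 'm"
  b_lo :: "real ^ 'm"
  delta :: real
  Cmin_hi :: "'k \<Rightarrow> real ^ 'n"
  Cmin_lo :: "'k \<Rightarrow> real ^ 'n"
  Pmax_hi :: "real ^ 'n"
  Pmax_lo :: "real ^ 'n"
  p0 :: "'s \<Rightarrow> real ^ 'n"
  phi :: "'k \<Rightarrow> (real ^ 'n) \<times> (real ^ 'n) \<Rightarrow> real"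
  Jcost :: "(real ^ 'n) \<times> (real ^ 'n) \<Rightarrow> real"

record ('k, 'n, 'm, 's) access_primal =
  C_hi :: "'k \<Rightarrow> real ^ ('n::finite)"
  C_lo :: "'k \<Rightarrow> real ^ 'n"
  P_hi :: "'s \<Rightarrow> real ^ 'n"
  P_lo :: "'s \<Rightarrow> real ^ 'n"
  t_hi :: "real ^ ('m::finite)"
  t_lo :: "real ^ 'm"
  gam_hi :: "'s \<Rightarrow> real ^ 'm"
  gam_lo :: "'s \<Rightarrow> real ^ 'm"

record ('k, 'n, 'm, 's) access_dual =
  eta_hi :: "'k \<Rightarrow> real ^ ('n::finite)"
  eta_lo :: "'k \<Rightarrow> real ^ 'n"
  omega_hi :: "'s \<Rightarrow> real ^ 'n"
  omega_lo :: "'s \<Rightarrow> real ^ 'n"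
  lambda_hi :: "'s \<Rightarrow> real ^ 'n"
  lambda_lo :: "'s \<Rightarrow> real ^ 'n"
  beta_hi :: "'s \<Rightarrow> real ^ ('m::finite)"
  beta_lo :: "'s \<Rightarrow> real ^ 'm"
  alpha_hi :: "'s \<Rightarrow> real ^ 'm"
  alpha_lo :: "'s \<Rightarrow> real ^ 'm"
  mu_hi :: "real ^ 'm"
  mu_lo :: "real ^ 'm"

definition scalar_pos :: "real \<Rightarrow> real" where
  "scalar_pos z = max z 0"

definition scalar_neg :: "real \<Rightarrow> real" where
  "scalar_neg z = scalar_pos z - z"

definition mat_pos :: "real ^ 'n ^ 'm \<Rightarrow> real ^ 'n ^ 'm" where
  "mat_pos A = (\<chi> i j. scalar_pos (A $ i $ j))"

definition mat_neg :: "real ^ 'n ^ 'm \<Rightarrow> real ^ 'n ^ 'm" where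
  "mat_neg A = (\<chi> i j. scalar_neg (A $ i $ j))"

text \<open>
  On vectors \<open>\<le>\<close> is the element-wise order and on pairs it is the product order, so \<open>mono\<close>
  below means non-decreasing in every one of the \<open>2N\<close> coordinates.  (On vectors \<open><\<close> is not
  element-wise; strict element-wise inequalities are therefore always spelled out.)
\<close>

definition access_problem ::
    "('k::finite, 'n::finite, 'm::finite, 's::finite) access_data \<Rightarrow> bool" where
  "access_problem D \<longleftrightarrow>
     0 \<le> delta D \<and> delta D < 1 \<and>
     (\<forall>k. 0 \<le> Cmin_hi D k \<and> 0 \<le> Cmin_lo D k) \<and>
     0 \<le> Pmax_hi D \<and> 0 \<le> Pmax_lo D \<and>
     (\<forall>k. concave_on UNIV (phi D k) \<and> mono (phi D k)) \<and>
     convex_on UNIV (Jcost D) \<and> mono (Jcost D) \<and> Jcost D differentiable_on UNIV"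

definition objective ::
    "('k::finite, 'n::finite, 'm::finite, 's::finite) access_data
      \<Rightarrow> ('k, 'n, 'm, 's) access_primal \<Rightarrow> real" where
  "objective D x =
     (\<Sum>k\<in>UNIV. phi D k (C_lo x k, C_hi x k))
     - 1 / real CARD('s) * (\<Sum>s\<in>UNIV. Jcost D (P_hi x s, P_lo x s))"

text \<open>The inequality constraints, each brought into the form \<open>g \<le> 0\<close> and named after its
  multiplier.\<close>

definition g_eta_hi :: "('k::finite, 'n::finite, 'm::finite, 's::finite) access_data
    \<Rightarrow> ('k, 'n, 'm, 's) access_primal \<Rightarrow> 'k \<Rightarrow> real ^ 'n" where
  "g_eta_hi D x k = Cmin_hi D k - C_hi x k"

definition g_eta_lo :: "('k::finite, 'n::finite, 'm::finite, 's::finite) access_data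
    \<Rightarrow> ('k, 'n, 'm, 's) access_primal \<Rightarrow> 'k \<Rightarrow> real ^ 'n" where
  "g_eta_lo D x k = Cmin_lo D k - C_lo x k"

definition g_omega_hi :: "('k::finite, 'n::finite, 'm::finite, 's::finite) access_data
    \<Rightarrow> ('k, 'n, 'm, 's) access_primal \<Rightarrow> 's \<Rightarrow> real ^ 'n" where
  "g_omega_hi D x s = P_hi x s - Pmax_hi D"

definition g_omega_lo :: "('k::finite, 'n::finite, 'm::finite, 's::finite) access_data
    \<Rightarrow> ('k, 'n, 'm, 's) access_primal \<Rightarrow> 's \<Rightarrow> real ^ 'n" where
  "g_omega_lo D x s = P_lo x s - Pmax_lo D"

definition g_beta_hi :: "('k::finite, 'n::finite, 'm::finite, 's::finite) access_data
    \<Rightarrow> ('k, 'n, 'm, 's) access_primal \<Rightarrow> 's \<Rightarrow> real ^ 'm" where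
  "g_beta_hi D x s =
     mat_pos (flowmat D) *v P_hi x s + mat_neg (flowmat D) *v P_lo x s
     - b_hi D - t_hi x - gam_hi x s"

definition g_beta_lo :: "('k::finite, 'n::finite, 'm::finite, 's::finite) access_data
    \<Rightarrow> ('k, 'n, 'm, 's) access_primal \<Rightarrow> 's \<Rightarrow> real ^ 'm" where
  "g_beta_lo D x s =
     mat_neg (flowmat D) *v P_hi x s + mat_pos (flowmat D) *v P_lo x s
     + b_lo D - t_lo x - gam_lo x s"

definition g_alpha_hi :: "('k::finite, 'n::finite, 'm::finite, 's::finite) access_data
    \<Rightarrow> ('k, 'n, 'm, 's) access_primal \<Rightarrow> 's \<Rightarrow> real ^ 'm" where
  "g_alpha_hi D x s = - gam_hi x s"

definition g_alpha_lo :: "('k::finite, 'n::finite, 'm::finite, 's::finite) access_data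
    \<Rightarrow> ('k, 'n, 'm, 's) access_primal \<Rightarrow> 's \<Rightarrow> real ^ 'm" where
  "g_alpha_lo D x s = - gam_lo x s"

definition g_mu_hi :: "('k::finite, 'n::finite, 'm::finite, 's::finite) access_data
    \<Rightarrow> ('k, 'n, 'm, 's) access_primal \<Rightarrow> real ^ 'm" where
  "g_mu_hi D x =
     t_hi x + (1 / (1 - delta D) * (1 / real CARD('s))) *\<^sub>R (\<Sum>s\<in>UNIV. gam_hi x s)"

definition g_mu_lo :: "('k::finite, 'n::finite, 'm::finite, 's::finite) access_data
    \<Rightarrow> ('k, 'n, 'm, 's) access_primal \<Rightarrow> real ^ 'm" where
  "g_mu_lo D x =
     t_lo x + (1 / (1 - delta D) * (1 / real CARD('s))) *\<^sub>R (\<Sum>s\<in>UNIV. gam_lo x s)"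

definition h_lambda_hi :: "('k::finite, 'n::finite, 'm::finite, 's::finite) access_data
    \<Rightarrow> ('k, 'n, 'm, 's) access_primal \<Rightarrow> 's \<Rightarrow> real ^ 'n" where
  "h_lambda_hi D x s = (\<Sum>k\<in>UNIV. C_hi x k) + p0 D s - P_hi x s"

definition h_lambda_lo :: "('k::finite, 'n::finite, 'm::finite, 's::finite) access_data
    \<Rightarrow> ('k, 'n, 'm, 's) access_primal \<Rightarrow> 's \<Rightarrow> real ^ 'n" where
  "h_lambda_lo D x s = (\<Sum>k\<in>UNIV. C_lo x k) - p0 D s - P_lo x s"

definition primal_feasible ::
    "('k::finite, 'n::finite, 'm::finite, 's::finite) access_data
      \<Rightarrow> ('k, 'n, 'm, 's) access_primal \<Rightarrow> bool" where
  "primal_feasible D x \<longleftrightarrow>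
     (\<forall>k. g_eta_hi D x k \<le> 0 \<and> g_eta_lo D x k \<le> 0) \<and>
     (\<forall>s. g_omega_hi D x s \<le> 0 \<and> g_omega_lo D x s \<le> 0) \<and>
     (\<forall>s. h_lambda_hi D x s = 0 \<and> h_lambda_lo D x s = 0) \<and>
     (\<forall>s. g_beta_hi D x s \<le> 0 \<and> g_beta_lo D x s \<le> 0) \<and>
     (\<forall>s. g_alpha_hi D x s \<le> 0 \<and> g_alpha_lo D x s \<le> 0) \<and>
     g_mu_hi D x \<le> 0 \<and> g_mu_lo D x \<le> 0"

definition dual_feasible ::
    "('k::finite, 'n::finite, 'm::finite, 's::finite) access_dual \<Rightarrow> bool" where
  "dual_feasible y \<longleftrightarrow>
     (\<forall>k. 0 \<le> eta_hi y k \<and> 0 \<le> eta_lo y k) \<and>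
     (\<forall>s. 0 \<le> omega_hi y s \<and> 0 \<le> omega_lo y s) \<and>
     (\<forall>s. 0 \<le> beta_hi y s \<and> 0 \<le> beta_lo y s) \<and>
     (\<forall>s. 0 \<le> alpha_hi y s \<and> 0 \<le> alpha_lo y s) \<and>
     0 \<le> mu_hi y \<and> 0 \<le> mu_lo y"

definition lagrangian ::
    "('k::finite, 'n::finite, 'm::finite, 's::finite) access_data
      \<Rightarrow> ('k, 'n, 'm, 's) access_dual \<Rightarrow> ('k, 'n, 'm, 's) access_primal \<Rightarrow> real" where
  "lagrangian D y x =
     - objective D x
     + (\<Sum>k\<in>UNIV. eta_hi y k \<bullet> g_eta_hi D x k + eta_lo y k \<bullet> g_eta_lo D x k)
     + (\<Sum>s\<in>UNIV. omega_hi y s \<bullet> g_omega_hi D x s + omega_lo y s \<bullet> g_omega_lo D x s)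
     + (\<Sum>s\<in>UNIV. beta_hi y s \<bullet> g_beta_hi D x s + beta_lo y s \<bullet> g_beta_lo D x s)
     + (\<Sum>s\<in>UNIV. alpha_hi y s \<bullet> g_alpha_hi D x s + alpha_lo y s \<bullet> g_alpha_lo D x s)
     + mu_hi y \<bullet> g_mu_hi D x + mu_lo y \<bullet> g_mu_lo D x
     + (\<Sum>s\<in>UNIV. lambda_hi y s \<bullet> h_lambda_hi D x s)
     + (\<Sum>s\<in>UNIV. lambda_lo y s \<bullet> h_lambda_lo D x s)"

definition compl_slack :: "real ^ 'i \<Rightarrow> real ^ 'i \<Rightarrow> bool" where
  "compl_slack u g \<longleftrightarrow> (\<forall>i. u $ i * g $ i = 0)"

definition complementary_slackness ::
    "('k::finite, 'n::finite, 'm::finite, 's::finite) access_data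
      \<Rightarrow> ('k, 'n, 'm, 's) access_primal \<Rightarrow> ('k, 'n, 'm, 's) access_dual \<Rightarrow> bool" where
  "complementary_slackness D x y \<longleftrightarrow>
     (\<forall>k. compl_slack (eta_hi y k) (g_eta_hi D x k) \<and>
          compl_slack (eta_lo y k) (g_eta_lo D x k)) \<and>
     (\<forall>s. compl_slack (omega_hi y s) (g_omega_hi D x s) \<and>
          compl_slack (omega_lo y s) (g_omega_lo D x s)) \<and>
     (\<forall>s. compl_slack (beta_hi y s) (g_beta_hi D x s) \<and>
          compl_slack (beta_lo y s) (g_beta_lo D x s)) \<and>
     (\<forall>s. compl_slack (alpha_hi y s) (g_alpha_hi D x s) \<and>
          compl_slack (alpha_lo y s) (g_alpha_lo D x s)) \<and>
     compl_slack (mu_hi y) (g_mu_hi D x) \<and> compl_slack (mu_lo y) (g_mu_lo D x)"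

definition primal_dual_optimal ::
    "('k::finite, 'n::finite, 'm::finite, 's::finite) access_data
      \<Rightarrow> ('k, 'n, 'm, 's) access_primal \<Rightarrow> ('k, 'n, 'm, 's) access_dual \<Rightarrow> bool" where
  "primal_dual_optimal D x y \<longleftrightarrow>
     primal_feasible D x \<and> dual_feasible y \<and> complementary_slackness D x y \<and>
     (\<forall>x'. lagrangian D y x \<le> lagrangian D y x')"


section \<open>Prices, payments and surpluses\<close>

definition price_hi :: "('k::finite, 'n::finite, 'm::finite, 's::finite) access_dual \<Rightarrow> real ^ 'n"
  where "price_hi y = (\<Sum>s\<in>UNIV. lambda_hi y s)"

definition price_lo :: "('k::finite, 'n::finite, 'm::finite, 's::finite) access_dual \<Rightarrow> real ^ 'n"
  where "price_lo y = (\<Sum>s\<in>UNIV. lambda_lo y s)"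

definition payment ::
    "('k::finite, 'n::finite, 'm::finite, 's::finite) access_primal
      \<Rightarrow> ('k, 'n, 'm, 's) access_dual \<Rightarrow> 'k \<Rightarrow> real" where
  "payment x y k = price_hi y \<bullet> C_hi x k + price_lo y \<bullet> C_lo x k"

definition DSO_surplus ::
    "('k::finite, 'n::finite, 'm::finite, 's::finite) access_data
      \<Rightarrow> ('k, 'n, 'm, 's) access_primal \<Rightarrow> ('k, 'n, 'm, 's) access_dual \<Rightarrow> real" where
  "DSO_surplus D x y =
     (\<Sum>k\<in>UNIV. payment x y k)
     - 1 / real CARD('s) *
       (\<Sum>s\<in>UNIV. Jcost D (P_hi x s, P_lo x s) - Jcost D (p0 D s, - p0 D s))"

definition DERA_surplus ::
    "('k::finite, 'n::finite, 'm::finite, 's::finite) access_data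
      \<Rightarrow> ('k, 'n, 'm, 's) access_primal \<Rightarrow> ('k, 'n, 'm, 's) access_dual \<Rightarrow> 'k \<Rightarrow> real" where
  "DERA_surplus D x y k = phi D k (C_lo x k, C_hi x k) - payment x y k"

definition gradient :: "('a::real_inner \<Rightarrow> real) \<Rightarrow> 'a \<Rightarrow> 'a" where
  "gradient f x = (THE g. GDERIV f x :> g)"

definition gradient_fst :: "('a::real_inner \<times> 'b \<Rightarrow> real) \<Rightarrow> 'a \<times> 'b \<Rightarrow> 'a" where
  "gradient_fst f z = gradient (\<lambda>u. f (u, snd z)) (fst z)"

definition gradient_snd :: "('a \<times> 'b::real_inner \<Rightarrow> real) \<Rightarrow> 'a \<times> 'b \<Rightarrow> 'b" where
  "gradient_snd f z = gradient (\<lambda>v. f (fst z, v)) (snd z)"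


section \<open>Radial networks and the LinDistFlow matrix\<close>

text \<open>
  A network on the vertex set \<open>UNIV :: 'n set\<close> is given by its set \<open>E\<close> of lines, each line being
  the two-element set of its end points.  Paths and cycles are lists of pairwise distinct vertices.
\<close>

definition path_lines :: "'n list \<Rightarrow> 'n set set" where
  "path_lines p = {{p ! i, p ! Suc i} | i. Suc i < length p}"

definition is_path :: "'n set set \<Rightarrow> 'n \<Rightarrow> 'n list \<Rightarrow> 'n \<Rightarrow> bool" where
  "is_path E u p v \<longleftrightarrow>
     p \<noteq> [] \<and> hd p = u \<and> last p = v \<and> distinct p \<and> path_lines p \<subseteq> E"

definition is_cycle :: "'n set set \<Rightarrow> 'n list \<Rightarrow> bool" where
  "is_cycle E p \<longleftrightarrow>
     3 \<le> length p \<and> distinct p \<and> path_lines p \<subseteq> E \<and> {last p, hd p} \<in> E"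

definition is_tree :: "'n set set \<Rightarrow> bool" where
  "is_tree E \<longleftrightarrow>
     (\<forall>e\<in>E. card e = 2) \<and> (\<forall>u v. \<exists>p. is_path E u p v) \<and> (\<nexists>p. is_cycle E p)"

text \<open>Only meaningful for trees, in which the path between two vertices is unique.\<close>

definition tree_path :: "'n set set \<Rightarrow> 'n \<Rightarrow> 'n \<Rightarrow> 'n list" where
  "tree_path E u v = (THE p. is_path E u p v)"

definition ancestor :: "'n set set \<Rightarrow> 'n \<Rightarrow> 'n \<Rightarrow> 'n \<Rightarrow> bool" where
  "ancestor E ref m n \<longleftrightarrow> m \<in> set (tree_path E ref n)"

definition path_incidence :: "'n set set \<Rightarrow> 'n \<Rightarrow> 'n set \<Rightarrow> 'n \<Rightarrow> real" where
  "path_incidence E ref e j = (if e \<in> path_lines (tree_path E ref j) then 1 else 0)"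

text \<open>
  The reference bus is an arbitrary bus \<open>ref\<close>.  The rows of \<open>A\<close> correspond one-to-one, via \<open>rows\<close>,
  to the lines (\<open>Inl\<close>, upper block) and the non-reference buses (\<open>Inr\<close>, lower block), so that
  there are \<open>2(N - 1)\<close> of them.  The entries of the lower block are those of twice the product of
  the transposed path incidence matrix, \<open>diag d\<close> and the path incidence matrix.
\<close>

definition lindistflow_entry ::
    "'n::finite set set \<Rightarrow> 'n \<Rightarrow> ('n set \<Rightarrow> real) \<Rightarrow> 'n set + 'n \<Rightarrow> 'n \<Rightarrow> real" where
  "lindistflow_entry E ref d q j =
     (if j = ref then 0
      else case q of
          Inl e \<Rightarrow> path_incidence E ref e j
        | Inr i \<Rightarrow> 2 * (\<Sum>e\<in>E. path_incidence E ref e i * d e * path_incidence E ref e j))"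

definition is_lindistflow_matrix ::
    "'n::finite set set \<Rightarrow> 'n \<Rightarrow> ('n set \<Rightarrow> real) \<Rightarrow> real ^ 'n ^ 'm \<Rightarrow> bool" where
  "is_lindistflow_matrix E ref d A \<longleftrightarrow>
     (\<exists>rows. bij_betw rows UNIV (E <+> (UNIV - {ref})) \<and>
        (\<forall>i j. A $ i $ j = lindistflow_entry E ref d (rows i) j))"

end

theory Submission
  imports Defs
begin

text \<open>
  The Lagrangian separates into one summand per DERA, one summand per scenario in the injections,
  and a part that depends on neither, so the optimal point minimizes every summand on its own.
  Fermat's rule for the scenario summands yields the price formulas.  Comparing the scenario
  summand at the optimum with its value at \<open>(p\<^sub>0, - p\<^sub>0)\<close> bounds the surplus of the DSO, because the
  access limits \<open>\<Sum>\<^sub>k C\<^sub>k\<close> are nonnegative; comparing the summand of a DERA with its value at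
  \<open>(0, 0)\<close> bounds its surplus by complementary slackness.  In a radial network the path to an
  ancestor is a prefix of the path to the descendant, so the LinDistFlow matrix is nonnegative and
  its columns increase along such paths.
\<close>

section \<open>Vectors, matrices and gradients\<close>

lemma inner_nonneg_vec:
  fixes a b :: "real ^ 'i::finite"
  assumes "0 \<le> a" "0 \<le> b"
  shows "0 \<le> a \<bullet> b"
  using assms by (auto simp: inner_vec_def less_eq_vec_def intro!: sum_nonneg)

lemma mat_pos_nonneg: "0 \<le> mat_pos A $ i $ j"
  by (simp add: mat_pos_def scalar_pos_def)

lemma mat_neg_nonneg: "0 \<le> mat_neg A $ i $ j"
  by (simp add: mat_neg_def scalar_neg_def scalar_pos_def)

lemma transpose_mult_vec_nonneg:
  fixes A :: "real ^ 'n ^ 'm::finite"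
  assumes "\<And>i j. 0 \<le> A $ i $ j" "0 \<le> v"
  shows "0 \<le> transpose A *v v"
  using assms
  by (auto simp: less_eq_vec_def matrix_vector_mult_def transpose_def intro!: sum_nonneg)

lemma inner_mult_vec_transpose:
  fixes A :: "real ^ 'n::finite ^ 'm::finite"
  shows "v \<bullet> (A *v u) = (transpose A *v v) \<bullet> u"
  by (simp add: dot_lmul_matrix transpose_matrix_vector)

lemma gradient_eqI:
  assumes "GDERIV f z :> g"
  shows "gradient f z = g"
  unfolding gradient_def
proof (rule the_equality)
  fix g' assume "GDERIV f z :> g'"
  then have "(\<lambda>h. h \<bullet> g') = (\<lambda>h. h \<bullet> g)"
    using assms unfolding gderiv_def by (rule has_derivative_unique)
  then have "h \<bullet> g' = h \<bullet> g" for h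
    by (rule fun_cong)
  then show "g' = g"
    using vector_eq_ldot by blast
qed (fact assms)

text \<open>Fermat's rule with a linear perturbation. In an incomplete inner product space a
  derivative need not be represented by a vector; here stationarity itself exhibits the representing
  vector \<open>(- 1 / a) *\<^sub>R c\<close>, so the gradient exists.\<close>

lemma gradient_at_minimum:
  fixes f :: "'a::real_inner \<Rightarrow> real"
  assumes "f differentiable (at z)" and "a \<noteq> 0"
    and min: "\<And>w. a * f z + c \<bullet> z \<le> a * f w + c \<bullet> w"
  shows "a *\<^sub>R gradient f z = - c"
proof -
  obtain f' where f': "(f has_derivative f') (at z)"
    using assms(1) by (auto simp: differentiable_def)
  have "((\<lambda>w. a * f w + c \<bullet> w) has_derivative (\<lambda>h. a * f' h + c \<bullet> h)) (at z)"
    by (auto intro!: derivative_eq_intros f')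
  then have "(\<lambda>h. a * f' h + c \<bullet> h) = (\<lambda>h. 0)"
    by (rule has_derivative_local_min) (simp add: min)
  then have "a * f' h = - (c \<bullet> h)" for h
    by (metis add.commute minus_unique)
  then have "f' = (\<lambda>h. ((- 1 / a) *\<^sub>R c) \<bullet> h)"
    using \<open>a \<noteq> 0\<close> by (simp add: field_simps fun_eq_iff)
  then have "GDERIV f z :> (- 1 / a) *\<^sub>R c"
    using f' by (simp add: gderiv_def inner_commute)
  then have "gradient f z = (- 1 / a) *\<^sub>R c"
    by (rule gradient_eqI)
  then show ?thesis
    using \<open>a \<noteq> 0\<close> by simp
qed


section \<open>Separation of the Lagrangian\<close>

text \<open>The coefficient of \<open>P_hi\<close> that the flow and injection limits contribute to
  the Lagrangian; in the price formulas it is what remains beside marginal cost.\<close>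

definition congestion_hi :: "('k::finite, 'n::finite, 'm::finite, 's::finite) access_data
    \<Rightarrow> ('k, 'n, 'm, 's) access_dual \<Rightarrow> 's \<Rightarrow> real ^ 'n" where
  "congestion_hi D y s = transpose (mat_pos (flowmat D)) *v beta_hi y s
     + transpose (mat_neg (flowmat D)) *v beta_lo y s + omega_hi y s"

definition congestion_lo :: "('k::finite, 'n::finite, 'm::finite, 's::finite) access_data
    \<Rightarrow> ('k, 'n, 'm, 's) access_dual \<Rightarrow> 's \<Rightarrow> real ^ 'n" where
  "congestion_lo D y s = transpose (mat_pos (flowmat D)) *v beta_lo y s
     + transpose (mat_neg (flowmat D)) *v beta_hi y s + omega_lo y s"

text \<open>\<open>c\<close> is the overlined and \<open>d\<close> the underlined access, opposite
  to the argument order of \<open>phi\<close>. Full prices occur because an access enters the power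
  balance of every scenario.\<close>

definition dera_lagrangian :: "('k::finite, 'n::finite, 'm::finite, 's::finite) access_data
    \<Rightarrow> ('k, 'n, 'm, 's) access_dual \<Rightarrow> 'k \<Rightarrow> real ^ 'n \<Rightarrow> real ^ 'n \<Rightarrow> real" where
  "dera_lagrangian D y k c d =
     - phi D k (d, c) + (price_hi y - eta_hi y k) \<bullet> c + (price_lo y - eta_lo y k) \<bullet> d"

definition scenario_lagrangian :: "('k::finite, 'n::finite, 'm::finite, 's::finite) access_data
    \<Rightarrow> ('k, 'n, 'm, 's) access_dual \<Rightarrow> 's \<Rightarrow> real ^ 'n \<Rightarrow> real ^ 'n \<Rightarrow> real" where
  "scenario_lagrangian D y s u v =
     1 / real CARD('s) * Jcost D (u, v)
     + (congestion_hi D y s - lambda_hi y s) \<bullet> u + (congestion_lo D y s - lambda_lo y s) \<bullet> v"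

text \<open>Reads only the \<open>t\<close> and \<open>gam\<close> fields of \<open>x\<close>, so it
  stays fixed when accesses or injections are changed.\<close>

definition residual_lagrangian :: "('k::finite, 'n::finite, 'm::finite, 's::finite) access_data
    \<Rightarrow> ('k, 'n, 'm, 's) access_dual \<Rightarrow> ('k, 'n, 'm, 's) access_primal \<Rightarrow> real" where
  "residual_lagrangian D y x =
     (\<Sum>k\<in>UNIV. eta_hi y k \<bullet> Cmin_hi D k + eta_lo y k \<bullet> Cmin_lo D k)
     - (\<Sum>s\<in>UNIV. omega_hi y s \<bullet> Pmax_hi D + omega_lo y s \<bullet> Pmax_lo D)
     + (\<Sum>s\<in>UNIV. beta_hi y s \<bullet> (- b_hi D - t_hi x - gam_hi x s)
                 + beta_lo y s \<bullet> (b_lo D - t_lo x - gam_lo x s))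
     + (\<Sum>s\<in>UNIV. alpha_hi y s \<bullet> g_alpha_hi D x s + alpha_lo y s \<bullet> g_alpha_lo D x s)
     + mu_hi y \<bullet> g_mu_hi D x + mu_lo y \<bullet> g_mu_lo D x
     + (\<Sum>s\<in>UNIV. lambda_hi y s \<bullet> p0 D s - lambda_lo y s \<bullet> p0 D s)"

text \<open>The exchange of sums that gathers the scenario multipliers into prices.\<close>

lemma inner_sum_sum:
  "(\<Sum>s\<in>S. f s \<bullet> (\<Sum>k\<in>K. g k)) = (\<Sum>k\<in>K. (\<Sum>s\<in>S. f s) \<bullet> g k)"
  by (simp add: inner_sum_left[symmetric] inner_sum_right[symmetric])

lemma sum_le_sum_update:
  fixes f f' :: "'i::finite \<Rightarrow> real"
  assumes "(\<Sum>i\<in>UNIV. f i) \<le> (\<Sum>i\<in>UNIV. f' i)" and "\<And>i. i \<noteq> j \<Longrightarrow> f' i = f i"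
  shows "f j \<le> f' j"
proof -
  have "(\<Sum>i\<in>UNIV - {j}. f' i) = (\<Sum>i\<in>UNIV - {j}. f i)"
    using assms(2) by (intro sum.cong) auto
  then show ?thesis
    using assms(1) by (simp only: sum.remove[OF finite UNIV_I, of _ j] add_le_cancel_right)
qed

text \<open>Transposition moves the flow matrix onto the multipliers. Once all products and sums are
  expanded, the two sides agree by linear arithmetic.\<close>

lemma lagrangian_split:
  "lagrangian D y x =
     (\<Sum>k\<in>UNIV. dera_lagrangian D y k (C_hi x k) (C_lo x k))
     + (\<Sum>s\<in>UNIV. scenario_lagrangian D y s (P_hi x s) (P_lo x s))
     + residual_lagrangian D y x"
  unfolding lagrangian_def objective_def dera_lagrangian_def scenario_lagrangian_def
    residual_lagrangian_def g_eta_hi_def g_eta_lo_def g_omega_hi_def g_omega_lo_def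
    g_beta_hi_def g_beta_lo_def h_lambda_hi_def h_lambda_lo_def congestion_hi_def congestion_lo_def
    price_hi_def price_lo_def
  by (simp only: inner_diff_left inner_diff_right inner_add_left inner_add_right
      inner_minus_left inner_minus_right inner_mult_vec_transpose sum.distrib sum_subtractf
      sum_negf inner_sum_sum sum_distrib_left)

section \<open>Consequences of optimality for multipliers, prices and surpluses\<close>

context
  fixes D :: "('k::finite, 'n::finite, 'm::finite, 's::finite) access_data"
    and x :: "('k, 'n, 'm, 's) access_primal"
    and y :: "('k, 'n, 'm, 's) access_dual"
  assumes problem: "access_problem D"
    and optimal: "primal_dual_optimal D x y"
begin

lemma lagrangian_minimal: "lagrangian D y x \<le> lagrangian D y x'"
  using optimal by (simp add: primal_dual_optimal_def)

text \<open>The Lagrangian is minimized without constraints, so the access of a single DERA may be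
  varied alone and all other summands cancel.\<close>

lemma dera_lagrangian_minimal:
  "dera_lagrangian D y k (C_hi x k) (C_lo x k) \<le> dera_lagrangian D y k c d"
proof -
  let ?x = "x\<lparr>C_hi := (C_hi x)(k := c), C_lo := (C_lo x)(k := d)\<rparr>"
  have "residual_lagrangian D y ?x = residual_lagrangian D y x"
    by (simp add: residual_lagrangian_def g_alpha_hi_def g_alpha_lo_def g_mu_hi_def g_mu_lo_def)
  then have "(\<Sum>k\<in>UNIV. dera_lagrangian D y k (C_hi x k) (C_lo x k))
      \<le> (\<Sum>k\<in>UNIV. dera_lagrangian D y k (C_hi ?x k) (C_lo ?x k))"
    using lagrangian_minimal[of ?x] by (simp add: lagrangian_split)
  from sum_le_sum_update[OF this, of k] show ?thesis
    by simp
qed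

lemma scenario_lagrangian_minimal:
  "scenario_lagrangian D y s (P_hi x s) (P_lo x s) \<le> scenario_lagrangian D y s u v"
proof -
  let ?x = "x\<lparr>P_hi := (P_hi x)(s := u), P_lo := (P_lo x)(s := v)\<rparr>"
  have "residual_lagrangian D y ?x = residual_lagrangian D y x"
    by (simp add: residual_lagrangian_def g_alpha_hi_def g_alpha_lo_def g_mu_hi_def g_mu_lo_def)
  then have "(\<Sum>s\<in>UNIV. scenario_lagrangian D y s (P_hi x s) (P_lo x s))
      \<le> (\<Sum>s\<in>UNIV. scenario_lagrangian D y s (P_hi ?x s) (P_lo ?x s))"
    using lagrangian_minimal[of ?x] by (simp add: lagrangian_split)
  from sum_le_sum_update[OF this, of s] show ?thesis
    by simp
qed

lemma Jcost_differentiable: "Jcost D differentiable (at z)"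
  using problem by (simp add: access_problem_def differentiable_on_def del: split_paired_All)

lemma Jcost_differentiable_fst: "(\<lambda>u. Jcost D (u, v)) differentiable (at u)"
proof -
  have "(\<lambda>u. (u, v)) differentiable (at u)"
    unfolding differentiable_def by (rule exI) (rule derivative_intros)+
  then show ?thesis
    using differentiable_chain_at[of "\<lambda>u. (u, v)" u "Jcost D"] Jcost_differentiable
    by (simp add: o_def)
qed

lemma Jcost_differentiable_snd: "(\<lambda>v. Jcost D (u, v)) differentiable (at v)"
proof -
  have "(\<lambda>v. (u, v)) differentiable (at v)"
    unfolding differentiable_def by (rule exI) (rule derivative_intros)+
  then show ?thesis
    using differentiable_chain_at[of "\<lambda>v. (u, v)" v "Jcost D"] Jcost_differentiable
    by (simp add: o_def)
qed

text \<open>Stationarity of the scenario summand in its first argument, the second being held at its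
  optimal value.\<close>

lemma lambda_hi_eq:
  "lambda_hi y s = (1 / real CARD('s)) *\<^sub>R gradient_fst (Jcost D) (P_hi x s, P_lo x s)
     + congestion_hi D y s"
proof -
  have "(1 / real CARD('s)) *\<^sub>R gradient (\<lambda>u. Jcost D (u, P_lo x s)) (P_hi x s)
      = - (congestion_hi D y s - lambda_hi y s)"
  proof (rule gradient_at_minimum)
    fix w
    show "1 / real CARD('s) * Jcost D (P_hi x s, P_lo x s)
        + (congestion_hi D y s - lambda_hi y s) \<bullet> P_hi x s
      \<le> 1 / real CARD('s) * Jcost D (w, P_lo x s) + (congestion_hi D y s - lambda_hi y s) \<bullet> w"
      using scenario_lagrangian_minimal[of s w "P_lo x s"]
      by (simp add: scenario_lagrangian_def)
  qed (use Jcost_differentiable_fst in auto)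
  then show ?thesis
    by (simp add: gradient_fst_def)
qed

lemma lambda_lo_eq:
  "lambda_lo y s = (1 / real CARD('s)) *\<^sub>R gradient_snd (Jcost D) (P_hi x s, P_lo x s)
     + congestion_lo D y s"
proof -
  have "(1 / real CARD('s)) *\<^sub>R gradient (\<lambda>v. Jcost D (P_hi x s, v)) (P_lo x s)
      = - (congestion_lo D y s - lambda_lo y s)"
  proof (rule gradient_at_minimum)
    fix w
    show "1 / real CARD('s) * Jcost D (P_hi x s, P_lo x s)
        + (congestion_lo D y s - lambda_lo y s) \<bullet> P_lo x s
      \<le> 1 / real CARD('s) * Jcost D (P_hi x s, w) + (congestion_lo D y s - lambda_lo y s) \<bullet> w"
      using scenario_lagrangian_minimal[of s "P_hi x s" w]
      by (simp add: scenario_lagrangian_def)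
  qed (use Jcost_differentiable_snd in auto)
  then show ?thesis
    by (simp add: gradient_snd_def)
qed

lemma price_hi_eq:
  "price_hi y =
     (\<Sum>s\<in>UNIV. (1 / real CARD('s)) *\<^sub>R gradient_fst (Jcost D) (P_hi x s, P_lo x s))
     + (\<Sum>s\<in>UNIV. congestion_hi D y s)"
  by (simp only: price_hi_def lambda_hi_eq sum.distrib)

lemma price_lo_eq:
  "price_lo y =
     (\<Sum>s\<in>UNIV. (1 / real CARD('s)) *\<^sub>R gradient_snd (Jcost D) (P_hi x s, P_lo x s))
     + (\<Sum>s\<in>UNIV. congestion_lo D y s)"
  by (simp only: price_lo_def lambda_lo_eq sum.distrib)

lemma multipliers_nonneg:
  "0 \<le> beta_hi y s" "0 \<le> beta_lo y s" "0 \<le> omega_hi y s" "0 \<le> omega_lo y s"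
  using optimal by (auto simp: primal_dual_optimal_def dual_feasible_def)

text \<open>The positive and negative parts have nonnegative entries whatever the signs in the flow
  matrix, and so do the multipliers they act on.\<close>

lemma congestion_nonneg: "0 \<le> congestion_hi D y s" "0 \<le> congestion_lo D y s"
  unfolding congestion_hi_def congestion_lo_def
  by (intro add_nonneg_nonneg transpose_mult_vec_nonneg mat_pos_nonneg mat_neg_nonneg
      multipliers_nonneg)+

lemma access_nonneg: "0 \<le> C_hi x k" "0 \<le> C_lo x k"
proof -
  have "0 \<le> Cmin_hi D k" "0 \<le> Cmin_lo D k"
    using problem by (auto simp: access_problem_def)
  moreover have "Cmin_hi D k \<le> C_hi x k" "Cmin_lo D k \<le> C_lo x k"
    using optimal
    by (auto simp: primal_dual_optimal_def primal_feasible_def g_eta_hi_def g_eta_lo_def)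
  ultimately show "0 \<le> C_hi x k" "0 \<le> C_lo x k"
    by (auto intro: order_trans)
qed

lemma injection_eq:
  "P_hi x s = (\<Sum>k\<in>UNIV. C_hi x k) + p0 D s" "P_lo x s = (\<Sum>k\<in>UNIV. C_lo x k) - p0 D s"
  using optimal
  by (auto simp: primal_dual_optimal_def primal_feasible_def h_lambda_hi_def h_lambda_lo_def)

lemma DSO_surplus_nonneg: "0 \<le> DSO_surplus D x y"
proof -
  define Chi where "Chi = (\<Sum>k\<in>UNIV. C_hi x k)"
  define Clo where "Clo = (\<Sum>k\<in>UNIV. C_lo x k)"
  have C: "0 \<le> Chi" "0 \<le> Clo"
    unfolding Chi_def Clo_def by (auto intro: sum_nonneg access_nonneg)
  \<comment> \<open>The optimal injections differ from \<open>(p0, - p0)\<close> by exactly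
    \<open>(Chi, Clo)\<close>. Minimality bounds the extra cost by the multipliers minus congestion,
    applied to \<open>(Chi, Clo)\<close>; dropping the nonnegative congestion part leaves this
    scenario's share of the payments.\<close>
  have "1 / real CARD('s) * (Jcost D (P_hi x s, P_lo x s) - Jcost D (p0 D s, - p0 D s))
      \<le> lambda_hi y s \<bullet> Chi + lambda_lo y s \<bullet> Clo" for s
  proof -
    have "0 \<le> congestion_hi D y s \<bullet> Chi" "0 \<le> congestion_lo D y s \<bullet> Clo"
      by (intro inner_nonneg_vec congestion_nonneg C)+
    then show ?thesis
      using scenario_lagrangian_minimal[of s "p0 D s" "- p0 D s"]
      by (simp add: scenario_lagrangian_def injection_eq Chi_def[symmetric] Clo_def[symmetric]
          algebra_simps inner_add_right inner_diff_right inner_diff_left diff_divide_distrib)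
  qed
  then have "(\<Sum>s\<in>UNIV.
        1 / real CARD('s) * (Jcost D (P_hi x s, P_lo x s) - Jcost D (p0 D s, - p0 D s)))
      \<le> (\<Sum>s\<in>UNIV. lambda_hi y s \<bullet> Chi + lambda_lo y s \<bullet> Clo)"
    by (intro sum_mono)
  also have "\<dots> = (\<Sum>k\<in>UNIV. payment x y k)"
    by (simp add: payment_def sum.distrib Chi_def Clo_def price_hi_def price_lo_def inner_sum_sum)
  finally show ?thesis
    by (simp only: DSO_surplus_def sum_distrib_left)
qed

lemma DERA_surplus_nonneg:
  assumes phi0: "0 \<le> phi D k (0, 0)"
    and "Cmin_hi D k = 0 \<and> Cmin_lo D k = 0
      \<or> (\<forall>i. Cmin_hi D k $ i < C_hi x k $ i) \<and> (\<forall>i. Cmin_lo D k $ i < C_lo x k $ i)"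
  shows "0 \<le> DERA_surplus D x y k"
proof -
  have "compl_slack (eta_hi y k) (g_eta_hi D x k)" "compl_slack (eta_lo y k) (g_eta_lo D x k)"
    using optimal by (auto simp: primal_dual_optimal_def complementary_slackness_def)
  \<comment> \<open>With zero minima this is complementary slackness up to sign; with non-binding
    minima the multiplier itself vanishes.\<close>
  then have slack: "eta_hi y k $ i * C_hi x k $ i = 0" "eta_lo y k $ i * C_lo x k $ i = 0" for i
    using assms(2) by (auto simp: compl_slack_def g_eta_hi_def g_eta_lo_def less_le)
  have "eta_hi y k \<bullet> C_hi x k = 0" "eta_lo y k \<bullet> C_lo x k = 0"
    by (simp_all only: inner_vec_def inner_real_def slack sum.neutral_const)
  \<comment> \<open>With the \<open>eta\<close> terms gone, the DERA summand at the optimum is minus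
    the surplus, while at \<open>(0, 0)\<close> it is \<open>- phi D k (0, 0)\<close>.\<close>
  then show ?thesis
    using dera_lagrangian_minimal[of k 0 0] phi0
    by (simp add: dera_lagrangian_def DERA_surplus_def payment_def inner_diff_left)
qed

lemma omega_eq_0_if_nonbinding:
  "P_hi x s $ i < Pmax_hi D $ i \<Longrightarrow> omega_hi y s $ i = 0"
  "P_lo x s $ i < Pmax_lo D $ i \<Longrightarrow> omega_lo y s $ i = 0"
  using optimal
  by (auto simp: primal_dual_optimal_def complementary_slackness_def compl_slack_def
      g_omega_hi_def g_omega_lo_def less_le)

text \<open>The gradients of \<open>Jcost\<close> are constant across buses, \<open>omega\<close>
  vanishes and the negative part of the matrix is zero. Prices thus differ between buses only
  through columns of the matrix weighted by nonnegative multipliers.\<close>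

lemma prices_mono_if_columns_mono:
  assumes nonneg: "\<And>q j. 0 \<le> flowmat D $ q $ j"
    and cols: "\<And>q. flowmat D $ q $ m \<le> flowmat D $ q $ n"
    and J: "\<And>P Q. Jcost D (P, Q) = (\<Sum>i\<in>UNIV. Jhi * P $ i) + (\<Sum>i\<in>UNIV. Jlo * Q $ i)"
    and nonbinding: "\<And>s i. P_hi x s $ i < Pmax_hi D $ i \<and> P_lo x s $ i < Pmax_lo D $ i"
  shows "price_hi y $ m \<le> price_hi y $ n" "price_lo y $ m \<le> price_lo y $ n"
proof -
  have pos: "mat_pos (flowmat D) = flowmat D" and neg: "mat_neg (flowmat D) = 0"
    using nonneg by (auto simp: mat_pos_def mat_neg_def scalar_neg_def scalar_pos_def vec_eq_iff)
  have inner_const: "(\<Sum>i\<in>UNIV. a * h $ i) = (\<chi> i. a) \<bullet> h" for a and h :: "real ^ 'n"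
    by (simp add: inner_vec_def)
  have "gradient_fst (Jcost D) (P, Q) = (\<chi> i. Jhi)"
    and "gradient_snd (Jcost D) (P, Q) = (\<chi> i. Jlo)" for P Q
    unfolding gradient_fst_def gradient_snd_def fst_conv snd_conv J inner_const
    by (rule gradient_eqI,
        auto simp: gderiv_def inner_commute intro!: derivative_eq_intros)+
  moreover have omega: "omega_hi y s = 0" "omega_lo y s = 0" for s
    using omega_eq_0_if_nonbinding nonbinding by (simp_all add: vec_eq_iff)
  moreover have "(transpose (flowmat D) *v v) $ m \<le> (transpose (flowmat D) *v v) $ n"
    if "0 \<le> v" for v
    using that cols
    by (auto simp: matrix_vector_mult_def transpose_def less_eq_vec_def
        intro!: sum_mono mult_right_mono)
  ultimately show "price_hi y $ m \<le> price_hi y $ n" "price_lo y $ m \<le> price_lo y $ n"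
    by (simp_all add: price_hi_eq price_lo_eq congestion_hi_def congestion_lo_def pos neg
        multipliers_nonneg sum_mono del: sum_constant)
qed

end


section \<open>Paths in trees\<close>

lemma path_lines_Nil [simp]: "path_lines [] = {}"
  and path_lines_single [simp]: "path_lines [a] = {}"
  by (auto simp: path_lines_def)

text \<open>Replaces indices by a recursion on the list: index 0 gives the new line, all other
  indices shift by one.\<close>

lemma path_lines_Cons [simp]: "path_lines (a # b # p) = insert {a, b} (path_lines (b # p))"
proof -
  have "{i. Suc i < length (a # b # p)} = insert 0 (Suc ` {i. Suc i < length (b # p)})"
    by (auto simp: image_iff less_Suc_eq_0_disj)
  then have "(\<lambda>i. {(a # b # p) ! i, (a # b # p) ! Suc i}) ` {i. Suc i < length (a # b # p)}
      = insert {a, b} ((\<lambda>i. {(b # p) ! i, (b # p) ! Suc i}) ` {i. Suc i < length (b # p)})"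
    by (simp add: image_image)
  then show ?thesis
    by (simp only: path_lines_def setcompr_eq_image)
qed

text \<open>The cut vertex \<open>w\<close> is kept in both pieces, so no line across the cut is
  lost.\<close>

lemma path_lines_append:
  "path_lines (p @ w # q) = path_lines (p @ [w]) \<union> path_lines (w # q)"
  by (induction p rule: induct_list012) auto

lemma path_lines_rev: "path_lines (rev p) = path_lines p"
proof (induction p rule: induct_list012)
  case (3 a b p)
  have "path_lines (rev (a # b # p)) = path_lines (rev p @ [b]) \<union> path_lines [b, a]"
    using path_lines_append[of "rev p" b "[a]"] by simp
  also have "path_lines (rev p @ [b]) = path_lines (b # p)"
    using 3(2) by simp
  finally show ?case
    by (auto simp: insert_commute)
qed auto

text \<open>Follow the first path until it first meets the second one again, at \<open>w\<close>,
  then return along the second path through \<open>b\<close> to \<open>u\<close>.\<close>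

lemma is_cycle_if_paths_diverge:
  assumes p: "is_path E u (u # a # p) v" and q: "is_path E u (u # b # q) v" and "a \<noteq> b"
  shows "\<exists>c. is_cycle E c"
proof -
  have "v \<in> set (a # p)" "v \<in> set (b # q)"
    using p q last_in_set[of "a # p"] last_in_set[of "b # q"]
    by (auto simp only: is_path_def last_ConsR list.distinct)
  then have "\<exists>w\<in>set (a # p). w \<in> set (b # q)"
    by (rule bexI[rotated])
  \<comment> \<open>Choosing the first meeting vertex keeps \<open>p1\<close> off the second path,
    which later makes the cycle's vertices distinct.\<close>
  then obtain p1 w p2 where p_eq: "a # p = p1 @ w # p2" and w: "w \<in> set (b # q)"
    and p1: "\<forall>z\<in>set p1. z \<notin> set (b # q)"
    using split_list_first_prop[of "a # p" "\<lambda>w. w \<in> set (b # q)"] by blast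
  from w obtain q1 q2 where q_eq: "b # q = q1 @ w # q2"
    by (meson split_list)
  have lines_p: "path_lines (u # p1 @ [w]) \<subseteq> E"
    using p path_lines_append[of "u # p1" w p2] by (auto simp: is_path_def p_eq)
  have "path_lines (q1 @ [w]) \<subseteq> path_lines (b # q)"
    using path_lines_append[of q1 w q2] by (auto simp: q_eq)
  then have lines_q: "path_lines (w # rev q1) \<subseteq> E"
    using q path_lines_rev[of "q1 @ [w]"] by (auto simp: is_path_def)
  have "{u, b} \<in> E"
    using q by (auto simp: is_path_def)
  \<comment> \<open>If \<open>q1\<close> is empty, then \<open>w\<close> is \<open>b\<close>
    itself.\<close>
  moreover have "last (w # rev q1) = b"
    using q_eq by (cases q1) auto
  ultimately have closing: "{last (u # p1 @ w # rev q1), u} \<in> E"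
    by (simp add: insert_commute)
  \<comment> \<open>If both were empty, \<open>w\<close> would equal both \<open>a\<close> and
    \<open>b\<close>; excluding this gives the third vertex of the cycle.\<close>
  have "p1 \<noteq> [] \<or> q1 \<noteq> []"
    using p_eq q_eq \<open>a \<noteq> b\<close> by auto
  then have len: "3 \<le> length (u # p1 @ w # rev q1)"
    by (cases p1; cases q1) auto
  have "distinct (u # p1 @ w # p2)" "distinct (u # q1 @ w # q2)"
    using p q by (auto simp only: is_path_def p_eq q_eq)
  then have dist: "distinct (u # p1 @ w # rev q1)"
    using p1 unfolding q_eq by auto
  have "path_lines (u # p1 @ w # rev q1) \<subseteq> E"
    using lines_p lines_q path_lines_append[of "u # p1" w "rev q1"] by simp
  with len dist closing show ?thesis
    unfolding is_cycle_def by (intro exI[of _ "u # p1 @ w # rev q1"]) auto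
qed

text \<open>Induction along the first path: if the second vertices differed there would be a cycle,
  so both paths can be shortened by their common start.\<close>

lemma path_unique_if_acyclic:
  assumes "\<nexists>c. is_cycle E c" "is_path E u p v" "is_path E u q v"
  shows "p = q"
  using assms(2,3)
proof (induction p arbitrary: u q)
  case Nil
  then show ?case by (simp add: is_path_def)
next
  case (Cons a p)
  obtain q' where q: "q = u # q'" and a: "a = u"
    using Cons.prems by (cases q) (auto simp: is_path_def)
  show ?case
  proof (cases "p = [] \<or> q' = []")
    case True
    \<comment> \<open>One path is the single vertex \<open>u\<close>, so \<open>u = v\<close>;
      distinctness then leaves no further vertex on the other.\<close>
    then show ?thesis
      using Cons.prems q a by (auto simp: is_path_def split: if_splits)
  next
    case False
    then obtain b p'' c q'' where eqs: "p = b # p''" "q' = c # q''"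
      by (meson neq_Nil_conv)
    have "b = c"
      using is_cycle_if_paths_diverge[of E u b p'' v c q''] Cons.prems assms(1)
      unfolding q a eqs by blast
    have "is_path E b p v" "is_path E b q' v"
      using Cons.prems \<open>b = c\<close> by (auto simp: is_path_def q eqs)
    then show ?thesis
      using Cons.IH q a by blast
  qed
qed

lemma tree_path_eqI:
  assumes "is_tree E" "is_path E u p v"
  shows "tree_path E u v = p"
  unfolding tree_path_def
  using assms path_unique_if_acyclic by (intro the_equality) (auto simp: is_tree_def)

lemma is_path_tree_path:
  assumes "is_tree E"
  shows "is_path E u (tree_path E u v) v"
proof -
  obtain p where "is_path E u p v"
    using assms unfolding is_tree_def by blast
  then show ?thesis
    using tree_path_eqI[OF assms] by simp
qed

text \<open>Cutting the path to \<open>n\<close> after \<open>m\<close> gives a path to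
  \<open>m\<close>, which by uniqueness is the tree path to \<open>m\<close>.\<close>

lemma path_lines_ancestor_subset:
  assumes "is_tree E" "ancestor E ref m n"
  shows "path_lines (tree_path E ref m) \<subseteq> path_lines (tree_path E ref n)"
proof -
  obtain p q where pq: "tree_path E ref n = p @ m # q"
    using split_list[of m] assms(2) unfolding ancestor_def by blast
  have "is_path E ref (p @ m # q) n"
    using is_path_tree_path[OF assms(1), of ref n] by (simp only: pq)
  then have "is_path E ref (p @ [m]) m"
    using path_lines_append[of p m q] by (cases p) (auto simp: is_path_def)
  then have "tree_path E ref m = p @ [m]"
    by (rule tree_path_eqI[OF assms(1)])
  then show ?thesis
    using pq path_lines_append[of p m q] by auto
qed

text \<open>Excludes the one harmful case for column monotonicity: the zero column of
  \<open>ref\<close> on the descendant's side.\<close>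

lemma ancestor_ref_imp_eq:
  assumes "is_tree E" "ancestor E ref m ref"
  shows "m = ref"
proof -
  have "tree_path E ref ref = [ref]"
    by (rule tree_path_eqI[OF assms(1)]) (simp add: is_path_def)
  then show ?thesis
    using assms(2) by (simp add: ancestor_def)
qed


section \<open>The LinDistFlow matrix\<close>

lemma path_incidence_nonneg: "0 \<le> path_incidence E ref e j"
  by (simp add: path_incidence_def)

lemma path_incidence_ancestor_mono:
  assumes "is_tree E" "ancestor E ref m n"
  shows "path_incidence E ref e m \<le> path_incidence E ref e n"
  using path_lines_ancestor_subset[OF assms] by (auto simp: path_incidence_def)

lemma lindistflow_entry_nonneg:
  assumes "\<And>e. e \<in> E \<Longrightarrow> 0 \<le> d e"
  shows "0 \<le> lindistflow_entry E ref d q j"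
  using assms
  by (auto simp: lindistflow_entry_def path_incidence_nonneg split: sum.split intro!: sum_nonneg)

text \<open>Away from \<open>ref\<close>, both blocks are nonnegative combinations of path
  incidences of the column bus, and these grow from ancestor to descendant.\<close>

lemma lindistflow_entry_ancestor_mono:
  assumes "is_tree E" "\<And>e. e \<in> E \<Longrightarrow> 0 \<le> d e" "ancestor E ref m n"
  shows "lindistflow_entry E ref d q m \<le> lindistflow_entry E ref d q n"
proof (cases "m = ref")
  case True
  then have "lindistflow_entry E ref d q m = 0"
    by (simp add: lindistflow_entry_def)
  then show ?thesis
    using lindistflow_entry_nonneg assms(2) by metis
next
  case False
  moreover have "n \<noteq> ref"
    using False assms(1,3) ancestor_ref_imp_eq by metis
  ultimately show ?thesis
    using assms
    by (auto simp: lindistflow_entry_def path_incidence_nonneg path_incidence_ancestor_mono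
        split: sum.split intro!: sum_mono mult_left_mono)
qed

section \<open>Assembly of the four claims\<close>

theorem proposition4:
  fixes D :: "('k::finite, 'n::finite, 'm::finite, 's::finite) access_data"
    and x :: "('k, 'n, 'm, 's) access_primal"
    and y :: "('k, 'n, 'm, 's) access_dual"
  assumes "access_problem D"
    and "primal_dual_optimal D x y"
  shows
    "(price_hi y =
        (\<Sum>s\<in>UNIV. (1 / real CARD('s)) *\<^sub>R gradient_fst (Jcost D) (P_hi x s, P_lo x s))
        + (\<Sum>s\<in>UNIV. transpose (mat_pos (flowmat D)) *v beta_hi y s
                   + transpose (mat_neg (flowmat D)) *v beta_lo y s + omega_hi y s)
      \<and> price_lo y =
        (\<Sum>s\<in>UNIV. (1 / real CARD('s)) *\<^sub>R gradient_snd (Jcost D) (P_hi x s, P_lo x s))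
        + (\<Sum>s\<in>UNIV. transpose (mat_pos (flowmat D)) *v beta_lo y s
                   + transpose (mat_neg (flowmat D)) *v beta_hi y s + omega_lo y s))
     \<and> 0 \<le> DSO_surplus D x y
     \<and> (\<forall>k. 0 \<le> phi D k (0, 0)
          \<and> (Cmin_hi D k = 0 \<and> Cmin_lo D k = 0
             \<or> (\<forall>i. Cmin_hi D k $ i < C_hi x k $ i) \<and> (\<forall>i. Cmin_lo D k $ i < C_lo x k $ i))
          \<longrightarrow> 0 \<le> DERA_surplus D x y k)
     \<and> (\<forall>(E :: 'n set set) (ref :: 'n) (r :: 'n set \<Rightarrow> real) (xr :: 'n set \<Rightarrow> real)
          (\<alpha> :: real) (Jhi :: real) (Jlo :: real).
          is_tree E
          \<and> (\<forall>e\<in>E. 0 \<le> r e + \<alpha> * xr e)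
          \<and> is_lindistflow_matrix E ref (\<lambda>e. r e + \<alpha> * xr e) (flowmat D)
          \<and> (\<forall>P Q. Jcost D (P, Q) = (\<Sum>i\<in>UNIV. Jhi * P $ i) + (\<Sum>i\<in>UNIV. Jlo * Q $ i))
          \<and> (\<forall>s i. P_hi x s $ i < Pmax_hi D $ i \<and> P_lo x s $ i < Pmax_lo D $ i)
          \<longrightarrow> (\<forall>m n. ancestor E ref m n
                 \<longrightarrow> price_hi y $ m \<le> price_hi y $ n \<and> price_lo y $ m \<le> price_lo y $ n))"
proof (intro conjI allI impI)
  show "price_hi y =
      (\<Sum>s\<in>UNIV. (1 / real CARD('s)) *\<^sub>R gradient_fst (Jcost D) (P_hi x s, P_lo x s))
      + (\<Sum>s\<in>UNIV. transpose (mat_pos (flowmat D)) *v beta_hi y s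
                 + transpose (mat_neg (flowmat D)) *v beta_lo y s + omega_hi y s)"
    using price_hi_eq[OF assms] by (simp only: congestion_hi_def)
  show "price_lo y =
      (\<Sum>s\<in>UNIV. (1 / real CARD('s)) *\<^sub>R gradient_snd (Jcost D) (P_hi x s, P_lo x s))
      + (\<Sum>s\<in>UNIV. transpose (mat_pos (flowmat D)) *v beta_lo y s
                 + transpose (mat_neg (flowmat D)) *v beta_hi y s + omega_lo y s)"
    using price_lo_eq[OF assms] by (simp only: congestion_lo_def)
  show "0 \<le> DSO_surplus D x y"
    using assms by (rule DSO_surplus_nonneg)
  show "0 \<le> DERA_surplus D x y k"
    if "0 \<le> phi D k (0, 0)
      \<and> (Cmin_hi D k = 0 \<and> Cmin_lo D k = 0
         \<or> (\<forall>i. Cmin_hi D k $ i < C_hi x k $ i) \<and> (\<forall>i. Cmin_lo D k $ i < C_lo x k $ i))" for k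
    using DERA_surplus_nonneg[OF assms] that by blast
next
  fix E :: "'n set set" and ref :: 'n and r xr :: "'n set \<Rightarrow> real" and \<alpha> Jhi Jlo :: real and m n
  assume network: "is_tree E
      \<and> (\<forall>e\<in>E. 0 \<le> r e + \<alpha> * xr e)
      \<and> is_lindistflow_matrix E ref (\<lambda>e. r e + \<alpha> * xr e) (flowmat D)
      \<and> (\<forall>P Q. Jcost D (P, Q) = (\<Sum>i\<in>UNIV. Jhi * P $ i) + (\<Sum>i\<in>UNIV. Jlo * Q $ i))
      \<and> (\<forall>s i. P_hi x s $ i < Pmax_hi D $ i \<and> P_lo x s $ i < Pmax_lo D $ i)"
    and anc: "ancestor E ref m n"
  let ?d = "\<lambda>e. r e + \<alpha> * xr e"
  obtain rows where A: "\<And>i j. flowmat D $ i $ j = lindistflow_entry E ref ?d (rows i) j"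
    using network by (auto simp: is_lindistflow_matrix_def)
  have nonneg: "0 \<le> flowmat D $ i $ j" for i j
    unfolding A using network by (intro lindistflow_entry_nonneg) blast
  have cols: "flowmat D $ i $ m \<le> flowmat D $ i $ n" for i
    unfolding A using network anc by (intro lindistflow_entry_ancestor_mono) blast+
  show "price_hi y $ m \<le> price_hi y $ n" "price_lo y $ m \<le> price_lo y $ n"
    using network by (auto intro!: prices_mono_if_columns_mono[OF assms nonneg cols])
qed

end
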